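(* Let $\{X_t\}_{t\ge 0}$ be a stationary stochastic process with values in a finite set $\{\beta_0,\ldots,\beta_{L-1}\}$. For integers $k>u\ge 0$ define the amount of information gained when considering $k$th-order transition probabilities instead of $u$th-order ones by $$G(u\to k)=\sum_{i_1,\ldots,i_k=0}^{L-1}p(\beta_{i_1},\ldots,\beta_{i_k})\,D_{\mathrm{KL}}\bigl(P(X|\beta_{i_1},\ldots,\beta_{i_k})\,\|\,P(X|\beta_{i_{k-u+1}},\ldots,\beta_{i_k})\bigr).$$ Then, for all integers $k>u\ge 0$, $$G(u\to k)=\sum_{l=u}^{k-1}\mathcal{G}_l,$$ where $\mathcal{G}_l$ denotes the predictability gain of the process.
   Context: For $r\ge1$, $p(\beta_{i_1},\ldots,\beta_{i_r})$ denotes the probability that $r$ consecutive values of the process are $\beta_{i_1},\ldots,\beta_{i_r}$ in temporal order (independent of the starting time by stationarity), and $p(\beta_j|\beta_{i_1},\ldots,\beta_{i_r})=p(\beta_{i_1},\ldots,\beta_{i_r},\beta_j)/p(\beta_{i_1},\ldots,\beta_{i_r})$ is the probability that the next value is $\beta_j$ given that the previous $r$ values were $\beta_{i_1},\ldots,\beta_{i_r}$. $P(X|\beta_{i_1},\ldots,\beta_{i_r})$ is the corresponding conditional distribution of the next value; when the conditioning block is empty (case $u=0$) it is the one-time marginal distribution $P(X)=\{p(\beta_i)\}$. The Kullback-Leibler divergence is $$D_{\mathrm{KL}}(P(X|y)\|P(X|z))=\sum_{i=0}^{L-1}p(\beta_i|y)\ln\frac{p(\beta_i|y)}{p(\beta_i|z)}.$$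 Terms in the sums whose block has probability zero are taken to be $0$, and $0\ln 0=0$. The block entropy of size $r\ge 1$ is $H_r=-\sum_{i_1,\ldots,i_r=0}^{L-1}p(\beta_{i_1},\ldots,\beta_{i_r})\ln p(\beta_{i_1},\ldots,\beta_{i_r})$, and $H_0=0$. The predictability gain is, for integer $u\ge 0$, $$\mathcal{G}_u=-(H_{u+2}-2H_{u+1}+H_u).$$ *)

theory Defs
  imports "HOL-Probability.Probability"
begin

text \<open>Strict stationarity: all finite-dimensional distributions are invariant under time shifts.\<close>

definition stationary_process :: "'w measure \<Rightarrow> 'a measure \<Rightarrow> (nat \<Rightarrow> 'w \<Rightarrow> 'a) \<Rightarrow> bool" where
  "stationary_process M N X \<longleftrightarrow>
     (\<forall>t. X t \<in> measurable M N) \<and>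
     (\<forall>h J. finite J \<longrightarrow>
        distr M (Pi\<^sub>M J (\<lambda>_. N)) (\<lambda>\<omega>. \<lambda>j\<in>J. X (j + h) \<omega>) =
        distr M (Pi\<^sub>M J (\<lambda>_. N)) (\<lambda>\<omega>. \<lambda>j\<in>J. X j \<omega>))"

definition words :: "'a set \<Rightarrow> nat \<Rightarrow> 'a list set" where
  "words A r = {xs. set xs \<subseteq> A \<and> length xs = r}"

text \<open>
  The word \<open>xs\<close> is read at time 0; by the lemma \<open>block_prob_shift\<close> below any other
  starting time gives the same value. The empty word has probability 1.
\<close>

definition block_prob :: "'w measure \<Rightarrow> (nat \<Rightarrow> 'w \<Rightarrow> 'a) \<Rightarrow> 'a list \<Rightarrow> real" where
  "block_prob M X xs = \<P>(\<omega> in M. \<forall>j<length xs. X j \<omega> = xs ! j)"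

text \<open>
  As a function of \<open>x\<close>, this is the conditional distribution of the next value given the past
  block \<open>xs\<close>; for \<open>xs = []\<close> it is the one-time marginal.
\<close>

definition trans_prob :: "'w measure \<Rightarrow> (nat \<Rightarrow> 'w \<Rightarrow> 'a) \<Rightarrow> 'a list \<Rightarrow> 'a \<Rightarrow> real" where
  "trans_prob M X xs x = block_prob M X (xs @ [x]) / block_prob M X xs"

text \<open>
  The divergence of \<open>p\<close> from \<open>q\<close> in nats; the factor \<open>p x\<close> makes the terms with \<open>p x = 0\<close> vanish.
  The library's \<open>KL_divergence\<close> takes its two measure arguments in the opposite order
  (lemma \<open>discrete_KL_eq_KL_divergence\<close>).
\<close>

definition discrete_KL :: "'a set \<Rightarrow> ('a \<Rightarrow> real) \<Rightarrow> ('a \<Rightarrow> real) \<Rightarrow> real" where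
  "discrete_KL A p q = (\<Sum>x\<in>A. p x * ln (p x / q x))"

text \<open>
  Words are in temporal order, so the most recent \<open>u\<close> values of a word of length \<open>k\<close> are
  \<open>drop (k - u) xs\<close>. Words of probability zero contribute 0 because of the leading factor.
\<close>

definition info_gain :: "'w measure \<Rightarrow> 'a set \<Rightarrow> (nat \<Rightarrow> 'w \<Rightarrow> 'a) \<Rightarrow> nat \<Rightarrow> nat \<Rightarrow> real" where
  "info_gain M A X u k =
     (\<Sum>xs\<in>words A k. block_prob M X xs *
        discrete_KL A (trans_prob M X xs) (trans_prob M X (drop (k - u) xs)))"

definition block_entropy :: "'w measure \<Rightarrow> 'a set \<Rightarrow> (nat \<Rightarrow> 'w \<Rightarrow> 'a) \<Rightarrow> nat \<Rightarrow> real" where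
  "block_entropy M A X r =
     (if r = 0 then 0 else - (\<Sum>xs\<in>words A r. block_prob M X xs * ln (block_prob M X xs)))"

definition predictability_gain :: "'w measure \<Rightarrow> 'a set \<Rightarrow> (nat \<Rightarrow> 'w \<Rightarrow> 'a) \<Rightarrow> nat \<Rightarrow> real" where
  "predictability_gain M A X u =
     - (block_entropy M A X (u + 2) - 2 * block_entropy M A X (u + 1) + block_entropy M A X u)"

lemma block_prob_shift:
  assumes "finite A" and st: "stationary_process M (count_space A) X" and xs: "set xs \<subseteq> A"
  shows "\<P>(\<omega> in M. \<forall>j<length xs. X (t + j) \<omega> = xs ! j) = block_prob M X xs"
proof -
  let ?J = "{..<length xs}"
  let ?P = "Pi\<^sub>M ?J (\<lambda>_. count_space A)"
  define E where "E = (\<Pi>\<^sub>E j\<in>?J. {xs ! j})"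
  have X: "X s \<in> measurable M (count_space A)" for s
    using st by (simp add: stationary_process_def)
  have E: "E \<in> sets ?P"
    unfolding E_def using xs by (intro sets_PiM_I_finite) (auto dest: nth_mem)
  have meas: "(\<lambda>\<omega>. \<lambda>j\<in>?J. X (j + h) \<omega>) \<in> measurable M ?P" for h
    using X by (intro measurable_restrict) auto
  have *: "measure (distr M ?P (\<lambda>\<omega>. \<lambda>j\<in>?J. X (j + h) \<omega>)) E =
      \<P>(\<omega> in M. \<forall>j<length xs. X (j + h) \<omega> = xs ! j)" for h
  proof -
    have "(\<lambda>j\<in>?J. X (j + h) \<omega>) \<in> E \<longleftrightarrow> (\<forall>j<length xs. X (j + h) \<omega> = xs ! j)" for \<omega>
      unfolding E_def PiE_iff by (simp add: Ball_def)
    then have "(\<lambda>\<omega>. \<lambda>j\<in>?J. X (j + h) \<omega>) -` E \<inter> space M =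
        {\<omega> \<in> space M. \<forall>j<length xs. X (j + h) \<omega> = xs ! j}"
      by blast
    then show ?thesis
      unfolding measure_distr[OF meas E] by (rule arg_cong)
  qed
  have "distr M ?P (\<lambda>\<omega>. \<lambda>j\<in>?J. X (j + t) \<omega>) = distr M ?P (\<lambda>\<omega>. \<lambda>j\<in>?J. X (j + 0) \<omega>)"
    using st by (simp add: stationary_process_def)
  then show ?thesis
    using *[of t] *[of 0] by (simp add: block_prob_def add.commute)
qed

lemma discrete_KL_eq_KL_divergence:
  assumes "finite A" "\<And>x. x \<in> A \<Longrightarrow> 0 \<le> p x" "\<And>x. x \<in> A \<Longrightarrow> 0 \<le> q x"
    and "\<And>x. x \<in> A \<Longrightarrow> q x = 0 \<Longrightarrow> p x = 0"
  shows "discrete_KL A p q = KL_divergence (exp 1) (point_measure A q) (point_measure A p)"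
proof -
  interpret sigma_finite_measure "count_space A"
    by (rule sigma_finite_measure_count_space_finite) fact
  have "KL_divergence (exp 1) (density (count_space A) q) (density (count_space A) p) =
      (\<integral>x. p x * log (exp 1) (p x / q x) \<partial>count_space A)"
    using assms by (intro KL_density_density) (auto simp: AE_count_space)
  then show ?thesis
    using assms(1) by (simp add: point_measure_def discrete_KL_def lebesgue_integral_count_space_finite log_def)
qed

end

theory Submission
  imports Defs
begin

text \<open>
  Expanding the logarithm, \<open>info_gain M A X u k\<close> is the expectation, over a random word of
  length \<open>k + 1\<close>, of the log-probabilities of the word itself and (with signs) of three of its
  subwords. By stationarity every subword is distributed as a block of its length, so the
  expectations are negated block entropies and
  \<open>G(u \<rightarrow> k) = (H k - H (k + 1)) - (H u - H (u + 1))\<close>, which is also the value of the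
  telescoping sum of predictability gains.
\<close>

section \<open>Sums over words, and the telescoping sum\<close>

lemma sum_words_add:
  "(\<Sum>ws\<in>words A (m + n). f ws) = (\<Sum>xs\<in>words A m. \<Sum>ys\<in>words A n. f (xs @ ys))"
proof -
  have "(\<Sum>ws\<in>words A (m + n). f ws) = (\<Sum>(xs, ys)\<in>words A m \<times> words A n. f (xs @ ys))"
    by (rule sum.reindex_bij_witness[of _ "\<lambda>(xs, ys). xs @ ys" "\<lambda>ws. (take m ws, drop m ws)"])
      (auto simp: words_def dest: in_set_takeD in_set_dropD)
  then show ?thesis
    by (simp add: sum.cartesian_product)
qed

lemma sum_words_Suc_0: "(\<Sum>ws\<in>words A (Suc 0). f ws) = (\<Sum>x\<in>A. f [x])"
  by (rule sum.reindex_bij_witness[of _ "\<lambda>x. [x]" hd]) (auto simp: words_def length_Suc_conv)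

lemma finite_words: "finite A \<Longrightarrow> finite (words A n)"
  unfolding words_def by (rule finite_lists_length_eq)

lemma sum_predictability_gain:
  assumes "u < k"
  shows "(\<Sum>l = u..k - 1. predictability_gain M A X l) =
    (block_entropy M A X k - block_entropy M A X (Suc k)) -
    (block_entropy M A X u - block_entropy M A X (Suc u))"
proof -
  let ?d = "\<lambda>l. block_entropy M A X l - block_entropy M A X (Suc l)"
  \<comment> \<open>A predictability gain is a forward difference of \<open>?d\<close>, as it is
    minus a second difference of entropies. Since \<open>u < k\<close>, the truncated
    \<open>k - 1\<close> is a true predecessor and the range is \<open>u..<k\<close>.\<close>
  have "(\<Sum>l = u..k - 1. predictability_gain M A X l) = (\<Sum>l = u..<k. ?d (Suc l) - ?d l)"
    using assms by (intro sum.cong) (auto simp: predictability_gain_def)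
  also have "\<dots> = ?d k - ?d u"
    using assms by (intro sum_Suc_diff') simp
  finally show ?thesis .
qed

section \<open>Cylinder events of the process\<close>

locale stationary_finite_process = prob_space M
  for M :: "'w measure" and A :: "'a set" and X :: "nat \<Rightarrow> 'w \<Rightarrow> 'a" +
  assumes finite_alphabet: "finite A"
    and stationary: "stationary_process M (count_space A) X"
begin

text \<open>The starting time is kept, so that the pieces of a split word can be placed at their own
  times on the same path.\<close>

definition cylinder :: "nat \<Rightarrow> 'a list \<Rightarrow> 'w set" where
  "cylinder t xs = {\<omega>\<in>space M. \<forall>j<length xs. X (t + j) \<omega> = xs ! j}"

lemma X_measurable [measurable]: "X t \<in> measurable M (count_space A)"
  using stationary by (simp add: stationary_process_def)

lemma X_in: "\<omega> \<in> space M \<Longrightarrow> X t \<omega> \<in> A"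
  using measurable_space[OF X_measurable] by simp

lemma cylinder_sets [measurable]: "cylinder t xs \<in> sets M"
proof -
  have "{\<omega>\<in>space M. X s \<omega> = a} \<in> sets M" for s a
  proof -
    \<comment> \<open>The singleton \<open>{a}\<close> is measurable in \<open>count_space A\<close>
      only for letters of \<open>A\<close>; for other \<open>a\<close> the event is empty.\<close>
    have "{\<omega>\<in>space M. X s \<omega> = a} = X s -` ({a} \<inter> A) \<inter> space M"
      using X_in by auto
    then show ?thesis
      using measurable_sets[OF X_measurable, of "{a} \<inter> A" s] by simp
  qed
  then show ?thesis
    unfolding cylinder_def by measurable
qed

text \<open>Time invariance enters here: \<open>t\<close> is free, so a subword can be evaluated
  wherever it stands in a longer word.\<close>

lemma block_prob_eq_cylinder:
  assumes "set xs \<subseteq> A"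
  shows "block_prob M X xs = prob (cylinder t xs)"
  using block_prob_shift[OF finite_alphabet stationary assms] by (simp add: cylinder_def)

lemma cylinder_append: "cylinder t (xs @ ys) = cylinder t xs \<inter> cylinder (t + length xs) ys"
proof -
  have "(\<forall>j<length xs + length ys. X (t + j) \<omega> = (xs @ ys) ! j) \<longleftrightarrow>
      (\<forall>j<length xs. X (t + j) \<omega> = xs ! j) \<and>
      (\<forall>j<length ys. X (t + length xs + j) \<omega> = ys ! j)" (is "?L \<longleftrightarrow> ?R") for \<omega>
  proof
    assume L: ?L
    have "X (t + j) \<omega> = xs ! j" if "j < length xs" for j
      using L[rule_format, of j] that by (simp add: nth_append)
    moreover have "X (t + length xs + j) \<omega> = ys ! j" if "j < length ys" for j
      using L[rule_format, of "length xs + j"] that by (simp add: nth_append add.assoc)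
    ultimately show ?R
      by blast
  next
    assume R: ?R
    show ?L
    proof (intro allI impI)
      fix j assume j: "j < length xs + length ys"
      show "X (t + j) \<omega> = (xs @ ys) ! j"
      proof (cases "j < length xs")
        case True
        then show ?thesis
          using R by (simp add: nth_append)
      next
        case False
        then show ?thesis
          using conjunct2[OF R, rule_format, of "j - length xs"] j by (simp add: nth_append)
      qed
    qed
  qed
  then show ?thesis
    by (auto simp: cylinder_def)
qed

text \<open>Each path reads exactly one word of length \<open>n\<close> from time \<open>t\<close>,
  so the cylinders cut \<open>B\<close> into disjoint pieces.\<close>

lemma sum_prob_cylinder_Int:
  assumes B: "B \<in> sets M"
  shows "(\<Sum>xs\<in>words A n. prob (cylinder t xs \<inter> B)) = prob B"
proof -
  have "disjoint_family_on (\<lambda>xs. cylinder t xs \<inter> B) (words A n)"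
    unfolding disjoint_family_on_def cylinder_def words_def
    by (auto simp: list_eq_iff_nth_eq)
  then have "(\<Sum>xs\<in>words A n. prob (cylinder t xs \<inter> B)) =
      prob (\<Union>xs\<in>words A n. cylinder t xs \<inter> B)"
    using B finite_alphabet by (intro finite_measure_finite_Union[symmetric] finite_words) auto
  also have "(\<Union>xs\<in>words A n. cylinder t xs \<inter> B) = B"
  proof (intro equalityI subsetI)
    fix \<omega> assume \<omega>: "\<omega> \<in> B"
    then have "\<omega> \<in> space M"
      using B sets.sets_into_space by blast
    then have "map (\<lambda>j. X (t + j) \<omega>) [0..<n] \<in> words A n"
      and "\<omega> \<in> cylinder t (map (\<lambda>j. X (t + j) \<omega>) [0..<n])"
      using X_in by (auto simp: words_def cylinder_def)
    with \<omega> show "\<omega> \<in> (\<Union>xs\<in>words A n. cylinder t xs \<inter> B)"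
      by blast
  qed auto
  finally show ?thesis .
qed

section \<open>Bounds and marginals of block probabilities\<close>

lemma block_prob_Nil: "block_prob M X [] = 1"
  using prob_space by (simp add: block_prob_def)

lemma block_prob_nonneg: "0 \<le> block_prob M X xs"
  by (simp add: block_prob_def)

text \<open>An intersection of two cylinders lies in each of them. These bounds later make every
  denominator positive once the longest word has positive probability.\<close>

lemma
  assumes "set (xs @ ys) \<subseteq> A"
  shows block_prob_append_le1: "block_prob M X (xs @ ys) \<le> block_prob M X xs"
    and block_prob_append_le2: "block_prob M X (xs @ ys) \<le> block_prob M X ys"
proof -
  have "block_prob M X (xs @ ys) = prob (cylinder 0 xs \<inter> cylinder (length xs) ys)"
    using block_prob_eq_cylinder[OF assms, of 0] by (simp add: cylinder_append)
  moreover have "block_prob M X xs = prob (cylinder 0 xs)"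
    and "block_prob M X ys = prob (cylinder (length xs) ys)"
    using assms by (simp_all add: block_prob_eq_cylinder)
  ultimately show "block_prob M X (xs @ ys) \<le> block_prob M X xs"
    and "block_prob M X (xs @ ys) \<le> block_prob M X ys"
    by (auto intro!: finite_measure_mono)
qed

text \<open>Summing out the past leaves \<open>ys\<close> read from time \<open>m\<close>;
  stationarity moves it back to time 0.\<close>

lemma sum_block_prob_append1:
  assumes "set ys \<subseteq> A"
  shows "(\<Sum>xs\<in>words A m. block_prob M X (xs @ ys)) = block_prob M X ys"
proof -
  have "block_prob M X (xs @ ys) = prob (cylinder 0 xs \<inter> cylinder m ys)" if "xs \<in> words A m" for xs
    using that assms by (simp add: words_def block_prob_eq_cylinder[of _ 0] cylinder_append)
  then show ?thesis
    using assms by (simp add: sum_prob_cylinder_Int block_prob_eq_cylinder[of ys m])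
qed

lemma sum_block_prob_append2:
  assumes "set xs \<subseteq> A"
  shows "(\<Sum>ys\<in>words A n. block_prob M X (xs @ ys)) = block_prob M X xs"
proof -
  have "block_prob M X (xs @ ys) = prob (cylinder (length xs) ys \<inter> cylinder 0 xs)"
    if "ys \<in> words A n" for ys
    using that assms
    by (simp add: words_def block_prob_eq_cylinder[of _ 0] cylinder_append Int_commute)
  then show ?thesis
    using assms by (simp add: sum_prob_cylinder_Int block_prob_eq_cylinder[of xs 0])
qed

lemma sum_block_prob_drop:
  "(\<Sum>ws\<in>words A (m + n). block_prob M X ws * f (drop m ws)) =
   (\<Sum>ys\<in>words A n. block_prob M X ys * f ys)"
proof -
  have "(\<Sum>ws\<in>words A (m + n). block_prob M X ws * f (drop m ws)) =
      (\<Sum>xs\<in>words A m. \<Sum>ys\<in>words A n. block_prob M X (xs @ ys) * f ys)"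
    unfolding sum_words_add by (intro sum.cong) (auto simp: words_def)
  \<comment> \<open>The prefix is summed innermost, because \<open>f\<close> depends on the suffix
    alone.\<close>
  also have "\<dots> = (\<Sum>ys\<in>words A n. (\<Sum>xs\<in>words A m. block_prob M X (xs @ ys)) * f ys)"
    by (subst sum.swap) (simp add: sum_distrib_right)
  also have "\<dots> = (\<Sum>ys\<in>words A n. block_prob M X ys * f ys)"
    by (intro sum.cong refl) (simp add: sum_block_prob_append1 words_def[of A n])
  finally show ?thesis .
qed

lemma sum_block_prob_take:
  "(\<Sum>ws\<in>words A (m + n). block_prob M X ws * f (take m ws)) =
   (\<Sum>xs\<in>words A m. block_prob M X xs * f xs)"
proof -
  have "(\<Sum>ws\<in>words A (m + n). block_prob M X ws * f (take m ws)) =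
      (\<Sum>xs\<in>words A m. \<Sum>ys\<in>words A n. block_prob M X (xs @ ys) * f xs)"
    unfolding sum_words_add by (intro sum.cong) (auto simp: words_def)
  also have "\<dots> = (\<Sum>xs\<in>words A m. block_prob M X xs * f xs)"
    by (intro sum.cong refl)
      (simp add: sum_distrib_right[symmetric] sum_block_prob_append2 words_def[of A m])
  finally show ?thesis .
qed

section \<open>From transition probabilities to entropies\<close>

lemma block_entropy_eq:
  "block_entropy M A X r = - (\<Sum>xs\<in>words A r. block_prob M X xs * ln (block_prob M X xs))"
  \<comment> \<open>The convention for \<open>r = 0\<close> agrees with the formula: the only word
    is empty, of probability 1, and \<open>ln 1 = 0\<close>.\<close>
  by (auto simp: block_entropy_def words_def block_prob_Nil intro!: sum.neutral)

lemma info_gain_summand: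
  fixes m :: nat
  assumes xs: "xs \<in> words A k" and "x \<in> A"
  defines "ys \<equiv> drop m xs"
  shows "block_prob M X xs *
      (trans_prob M X xs x * ln (trans_prob M X xs x / trans_prob M X ys x)) =
    block_prob M X (xs @ [x]) * (ln (block_prob M X (xs @ [x])) - ln (block_prob M X xs)
      - ln (block_prob M X (ys @ [x])) + ln (block_prob M X ys))"
proof (cases "block_prob M X (xs @ [x]) = 0")
  \<comment> \<open>Both sides vanish, the left one because \<open>trans_prob M X xs x\<close> has
    numerator 0.\<close>
  case True
  then show ?thesis
    by (simp add: trans_prob_def)
next
  case False
  then have pos: "0 < block_prob M X (xs @ [x])"
    using block_prob_nonneg[of "xs @ [x]"] by linarith
  have sub: "set (xs @ [x]) \<subseteq> A"
    using xs \<open>x \<in> A\<close> by (auto simp: words_def)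
  \<comment> \<open>Exhibits \<open>ys @ [x]\<close> as a suffix of the full word, so that its
    probability is bounded below by that of the word.\<close>
  have split: "take m xs @ ys @ [x] = xs @ [x]"
    by (simp add: ys_def)
  have sub': "set (take m xs @ ys @ [x]) \<subseteq> A" "set (ys @ [x]) \<subseteq> A"
    unfolding split using sub by (auto simp: ys_def dest: in_set_dropD)
  have "0 < block_prob M X xs"
    using block_prob_append_le1[OF sub] pos by linarith
  moreover have pos': "0 < block_prob M X (ys @ [x])"
    using block_prob_append_le2[OF sub'(1)] pos unfolding split by linarith
  moreover have "0 < block_prob M X ys"
    using block_prob_append_le1[OF sub'(2)] pos' by linarith
  \<comment> \<open>With all four probabilities positive, the logarithm splits and the factor
    \<open>block_prob M X xs\<close> cancels the denominator of the first transition
    probability.\<close>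
  ultimately show ?thesis
    using pos by (simp add: trans_prob_def ln_div ln_mult)
qed

lemma info_gain_eq_entropies:
  assumes "u < k"
  shows "info_gain M A X u k =
    (block_entropy M A X k - block_entropy M A X (Suc k)) -
    (block_entropy M A X u - block_entropy M A X (Suc u))"
proof -
  define m where "m = k - u"
  let ?p = "block_prob M X"
  let ?l = "\<lambda>xs. ln (?p xs)"
  have k: "k = m + u" "Suc k = m + Suc u" "Suc k = k + Suc 0"
    using assms by (simp_all add: m_def)
  have "info_gain M A X u k = (\<Sum>xs\<in>words A k. \<Sum>x\<in>A. ?p (xs @ [x]) *
      (?l (xs @ [x]) - ?l xs - ?l (drop m xs @ [x]) + ?l (drop m xs)))"
    unfolding info_gain_def discrete_KL_def sum_distrib_left m_def[symmetric]
    by (intro sum.cong refl info_gain_summand)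
  \<comment> \<open>Past word and next letter merge into one word \<open>ws\<close>; as
    \<open>m\<close> \<le> \<open>k\<close>, dropping \<open>m\<close> letters commutes with
    appending the letter.\<close>
  also have "\<dots> = (\<Sum>ws\<in>words A (Suc k). ?p ws *
      (?l ws - ?l (take k ws) - ?l (drop m ws) + ?l (drop m (take k ws))))"
    unfolding k(3) sum_words_add sum_words_Suc_0
    by (intro sum.cong refl) (auto simp: words_def m_def)
  also have "\<dots> = (\<Sum>ws\<in>words A (Suc k). ?p ws * ?l ws)
      - (\<Sum>ws\<in>words A (Suc k). ?p ws * ?l (take k ws))
      - (\<Sum>ws\<in>words A (Suc k). ?p ws * ?l (drop m ws))
      + (\<Sum>ws\<in>words A (Suc k). ?p ws * ?l (drop m (take k ws)))"
    by (simp only: sum.distrib sum_subtractf distrib_left right_diff_distrib)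
  also have "(\<Sum>ws\<in>words A (Suc k). ?p ws * ?l (take k ws)) = (\<Sum>ws\<in>words A k. ?p ws * ?l ws)"
    unfolding k(3) by (rule sum_block_prob_take)
  also have "(\<Sum>ws\<in>words A (Suc k). ?p ws * ?l (drop m ws)) =
      (\<Sum>ws\<in>words A (Suc u). ?p ws * ?l ws)"
    unfolding k(2) by (rule sum_block_prob_drop)
  \<comment> \<open>This subword is interior, so it is reached in two stages: first the last letter
    is summed out, then the first \<open>m\<close> letters.\<close>
  also have "(\<Sum>ws\<in>words A (Suc k). ?p ws * ?l (drop m (take k ws))) =
      (\<Sum>ws\<in>words A k. ?p ws * ?l (drop m ws))"
    unfolding k(3) by (rule sum_block_prob_take)
  also have "\<dots> = (\<Sum>ws\<in>words A u. ?p ws * ?l ws)"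
    unfolding k(1) by (rule sum_block_prob_drop)
  finally show ?thesis
    by (simp add: block_entropy_eq)
qed

end

theorem proposition1:
  fixes M :: "'w measure" and A :: "'a set" and X :: "nat \<Rightarrow> 'w \<Rightarrow> 'a" and u k :: nat
  assumes "prob_space M"
    and "finite A"
    and "stationary_process M (count_space A) X"
    and "u < k"
  shows "info_gain M A X u k = (\<Sum>l = u..k - 1. predictability_gain M A X l)"
proof -
  interpret prob_space M by fact
  interpret stationary_finite_process M A X
    using assms(2,3) by unfold_locales
  show ?thesis
    using info_gain_eq_entropies sum_predictability_gain assms(4) by metis
qed

end
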